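(* Let $n\in\mathbb{N}$ and let $\mathbf{k}$ be a commutative ring. Let $j\in[n]$, and let $m$ be a positive integer. Let $k_1,k_2,\ldots,k_m$ be any $m$ elements of $[j]$ (not necessarily distinct) satisfying $m\geq j-k_m+1$. Then, in $\mathbf{k}[S_n]$, $$[t_{k_1},t_j]\,[t_{k_2},t_j]\cdots[t_{k_m},t_j]=0.$$
   Context: Here $\mathbb{N}=\{0,1,2,\ldots\}$, and $[m]:=\{1,2,\ldots,m\}$. $S_n$ is the symmetric group on $[n]$, with product $(\pi\sigma)(i)=\pi(\sigma(i))$, viewed as a subset of the group algebra $\mathbf{k}[S_n]$. For distinct $i_1,\ldots,i_k\in[n]$, $\operatorname{cyc}_{i_1,\ldots,i_k}\in S_n$ is the cycle sending $i_1\mapsto i_2\mapsto\cdots\mapsto i_k\mapsto i_1$ and fixing all other elements (so $\operatorname{cyc}_i=\operatorname{id}=1$). For each $\ell\in[n]$, the somewhere-to-below shuffle is $t_\ell:=\operatorname{cyc}_{\ell}+\operatorname{cyc}_{\ell,\ell+1}+\operatorname{cyc}_{\ell,\ell+1,\ell+2}+\cdots+\operatorname{cyc}_{\ell,\ell+1,\ldots,n}\in\mathbf{k}[S_n]$. For elements $a,b$ of a ring, $[a,b]:=ab-ba$ is the commutator. *)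

theory Defs
  imports "HOL-Algebra.Sym_Groups" "HOL-Algebra.Ring"
begin

text \<open>
  The group algebra \<open>R[G]\<close> of a finite group \<open>G\<close> over a commutative ring \<open>R\<close>: its elements
  are the coefficient functions \<open>carrier G \<rightarrow> carrier R\<close> and its product is convolution.
  Finiteness of \<open>G\<close> is needed, because \<^const>\<open>finsum\<close> over an infinite set is zero
  and because no finite-support condition is imposed.
\<close>

definition group_algebra ::
  "('r, 's) ring_scheme \<Rightarrow> ('g, 'h) monoid_scheme \<Rightarrow> ('g \<Rightarrow> 'r) ring" where
  "group_algebra R G =
     \<lparr> carrier = carrier G \<rightarrow>\<^sub>E carrier R,
       mult = (\<lambda>f g. \<lambda>x\<in>carrier G.
                 \<Oplus>\<^bsub>R\<^esub>y\<in>carrier G. f y \<otimes>\<^bsub>R\<^esub> g (inv\<^bsub>G\<^esub> y \<otimes>\<^bsub>G\<^esub> x)),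
       one = (\<lambda>x\<in>carrier G. if x = \<one>\<^bsub>G\<^esub> then \<one>\<^bsub>R\<^esub> else \<zero>\<^bsub>R\<^esub>),
       zero = (\<lambda>x\<in>carrier G. \<zero>\<^bsub>R\<^esub>),
       add = (\<lambda>f g. \<lambda>x\<in>carrier G. f x \<oplus>\<^bsub>R\<^esub> g x) \<rparr>"

definition group_algebra_of ::
  "('r, 's) ring_scheme \<Rightarrow> ('g, 'h) monoid_scheme \<Rightarrow> 'g \<Rightarrow> 'g \<Rightarrow> 'r" where
  "group_algebra_of R G p = (\<lambda>x\<in>carrier G. if x = p then \<one>\<^bsub>R\<^esub> else \<zero>\<^bsub>R\<^esub>)"

abbreviation sym_algebra :: "('r, 's) ring_scheme \<Rightarrow> nat \<Rightarrow> ((nat \<Rightarrow> nat) \<Rightarrow> 'r) ring" where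
  "sym_algebra R n \<equiv> group_algebra R (sym_group n)"

definition ring_commutator :: "('a, 'b) ring_scheme \<Rightarrow> 'a \<Rightarrow> 'a \<Rightarrow> 'a" where
  "ring_commutator A a b = a \<otimes>\<^bsub>A\<^esub> b \<ominus>\<^bsub>A\<^esub> b \<otimes>\<^bsub>A\<^esub> a"

text \<open>
  The list \<open>[l..<Suc i]\<close> is \<open>l, l + 1, \<dots>, i\<close>, and \<^const>\<open>cycle_of_list\<close> sends each entry of
  its argument to the next one and the last entry to the first.
\<close>

definition somewhere_to_below ::
  "('r, 's) ring_scheme \<Rightarrow> nat \<Rightarrow> nat \<Rightarrow> (nat \<Rightarrow> nat) \<Rightarrow> 'r" where
  "somewhere_to_below R n l =
     (\<Oplus>\<^bsub>sym_algebra R n\<^esub>i\<in>{l..n}.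
        group_algebra_of R (sym_group n) (cycle_of_list [l..<Suc i]))"

lemma (in abelian_monoid) finsum_swap:
  assumes "finite A" "finite B" "\<And>a b. a \<in> A \<Longrightarrow> b \<in> B \<Longrightarrow> f a b \<in> carrier G"
  shows "(\<Oplus>a\<in>A. \<Oplus>b\<in>B. f a b) = (\<Oplus>b\<in>B. \<Oplus>a\<in>A. f a b)"
  using assms(1,3)
proof (induction A rule: finite_induct)
  case empty
  then show ?case by simp
next
  case (insert a A)
  have cl: "f a b \<in> carrier G" if "b \<in> B" for b
    using insert.prems that by blast
  have clA: "f x b \<in> carrier G" if "x \<in> A" "b \<in> B" for x b
    using insert.prems that by blast
  have sB: "(\<Oplus>b\<in>B. f x b) \<in> carrier G" if "x \<in> insert a A" for x
    using insert.prems that by (intro finsum_closed Pi_I) blast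
  have sA: "(\<Oplus>x\<in>A. f x b) \<in> carrier G" if "b \<in> B" for b
    using clA that by (intro finsum_closed Pi_I) blast
  have IH: "(\<Oplus>x\<in>A. \<Oplus>b\<in>B. f x b) = (\<Oplus>b\<in>B. \<Oplus>x\<in>A. f x b)"
    by (rule insert.IH) (rule clA)
  have "(\<Oplus>x\<in>insert a A. \<Oplus>b\<in>B. f x b) = (\<Oplus>b\<in>B. f a b) \<oplus> (\<Oplus>x\<in>A. \<Oplus>b\<in>B. f x b)"
    by (rule finsum_insert[OF insert.hyps]) (auto intro: sB)
  also have "\<dots> = (\<Oplus>b\<in>B. f a b \<oplus> (\<Oplus>x\<in>A. f x b))"
    unfolding IH by (rule finsum_addf[symmetric]) (auto intro: cl sA)
  also have "\<dots> = (\<Oplus>b\<in>B. \<Oplus>x\<in>insert a A. f x b)"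
  proof (rule finsum_cong'[OF refl])
    show "(\<lambda>b. \<Oplus>x\<in>insert a A. f x b) \<in> B \<rightarrow> carrier G"
      using insert.prems by (intro Pi_I finsum_closed) blast
    show "f a b \<oplus> (\<Oplus>x\<in>A. f x b) = (\<Oplus>x\<in>insert a A. f x b)" if "b \<in> B" for b
      by (rule finsum_insert[OF insert.hyps, symmetric]) (use cl clA that in auto)
  qed
  finally show ?case .
qed

lemma (in group) bij_betw_mult_left:
  assumes "z \<in> carrier G"
  shows "inj_on (\<lambda>w. z \<otimes> w) (carrier G)" "(\<lambda>w. z \<otimes> w) ` carrier G = carrier G"
proof -
  show "inj_on (\<lambda>w. z \<otimes> w) (carrier G)"
    using assms by (auto intro!: inj_onI)
  have "y \<in> (\<lambda>w. z \<otimes> w) ` carrier G" if "y \<in> carrier G" for y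
    using assms that by (intro image_eqI[of _ _ "inv z \<otimes> y"]) (auto simp: m_assoc[symmetric])
  then show "(\<lambda>w. z \<otimes> w) ` carrier G = carrier G"
    using assms by auto
qed

lemma ring_group_algebra:
  fixes R (structure) and G :: "('g, 'h) monoid_scheme"
  assumes "cring R" "group G" "finite (carrier G)"
  shows "ring (group_algebra R G)"
proof -
  interpret R: cring R by fact
  interpret G: group G by fact
  note fin = assms(3)
  let ?A = "group_algebra R G"
  have closed: "f y \<in> carrier R" if "f \<in> carrier ?A" "y \<in> carrier G" for f y
    using that by (auto simp: group_algebra_def)
  have ext: "f = g" if "f \<in> carrier ?A" "g \<in> carrier ?A" "\<And>x. x \<in> carrier G \<Longrightarrow> f x = g x" for f g
    using that by (auto simp: group_algebra_def intro: PiE_ext)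
  have mult: "(f \<otimes>\<^bsub>?A\<^esub> g) x = (\<Oplus>y\<in>carrier G. f y \<otimes> g (inv\<^bsub>G\<^esub> y \<otimes>\<^bsub>G\<^esub> x))"
    if "x \<in> carrier G" for f g x
    using that by (simp add: group_algebra_def)
  have add: "(f \<oplus>\<^bsub>?A\<^esub> g) x = f x \<oplus> g x" if "x \<in> carrier G" for f g x
    using that by (simp add: group_algebra_def)
  have mult_closed: "f \<otimes>\<^bsub>?A\<^esub> g \<in> carrier ?A" if "f \<in> carrier ?A" "g \<in> carrier ?A" for f g
    using closed[OF that(1)] closed[OF that(2)] mult[of _ f g]
    by (auto simp: group_algebra_def intro!: R.finsum_closed)
  have add_closed: "f \<oplus>\<^bsub>?A\<^esub> g \<in> carrier ?A" if "f \<in> carrier ?A" "g \<in> carrier ?A" for f g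
    using that by (auto simp: group_algebra_def PiE_mem)
  have zero_closed: "\<zero>\<^bsub>?A\<^esub> \<in> carrier ?A"
    by (auto simp: group_algebra_def)
  have one_closed: "\<one>\<^bsub>?A\<^esub> \<in> carrier ?A"
    by (auto simp: group_algebra_def)
  have one: "\<one>\<^bsub>?A\<^esub> x = (if x = \<one>\<^bsub>G\<^esub> then \<one> else \<zero>)" if "x \<in> carrier G" for x
    using that by (simp add: group_algebra_def)
  have ab: "abelian_group ?A"
  proof (rule abelian_groupI)
    fix f assume f: "f \<in> carrier ?A"
    show "\<exists>g\<in>carrier ?A. g \<oplus>\<^bsub>?A\<^esub> f = \<zero>\<^bsub>?A\<^esub>"
      using closed[OF f] f
      by (intro bexI[of _ "\<lambda>x\<in>carrier G. \<ominus> f x"]) (auto simp: group_algebra_def R.l_neg)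
    show "\<zero>\<^bsub>?A\<^esub> \<oplus>\<^bsub>?A\<^esub> f = f"
    proof (rule ext)
      show "\<zero>\<^bsub>?A\<^esub> \<oplus>\<^bsub>?A\<^esub> f \<in> carrier ?A"
        using f zero_closed by (intro add_closed)
      show "(\<zero>\<^bsub>?A\<^esub> \<oplus>\<^bsub>?A\<^esub> f) x = f x" if "x \<in> carrier G" for x
        using that closed[OF f that] by (simp add: group_algebra_def)
    qed (rule f)
  next
    fix f g assume fg: "f \<in> carrier ?A" "g \<in> carrier ?A"
    show "f \<oplus>\<^bsub>?A\<^esub> g = g \<oplus>\<^bsub>?A\<^esub> f"
      using fg by (intro ext add_closed) (auto simp: add closed R.a_comm)
  next
    fix f g h assume fgh: "f \<in> carrier ?A" "g \<in> carrier ?A" "h \<in> carrier ?A"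
    show "f \<oplus>\<^bsub>?A\<^esub> g \<oplus>\<^bsub>?A\<^esub> h = f \<oplus>\<^bsub>?A\<^esub> (g \<oplus>\<^bsub>?A\<^esub> h)"
      using fgh by (intro ext add_closed) (auto simp: add closed R.a_assoc)
  qed (use add_closed in \<open>auto simp: group_algebra_def\<close>)
  have mon: "monoid ?A"
  proof (rule monoidI)
    fix f assume f: "f \<in> carrier ?A"
    show "\<one>\<^bsub>?A\<^esub> \<otimes>\<^bsub>?A\<^esub> f = f"
    proof (rule ext)
      fix x assume x: "x \<in> carrier G"
      have "(\<one>\<^bsub>?A\<^esub> \<otimes>\<^bsub>?A\<^esub> f) x =
            (\<Oplus>y\<in>carrier G. if y = \<one>\<^bsub>G\<^esub> then f (inv\<^bsub>G\<^esub> y \<otimes>\<^bsub>G\<^esub> x) else \<zero>)"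
        unfolding mult[OF x] using x by (intro R.finsum_cong') (auto simp: one closed[OF f])
      also have "\<dots> = f (inv\<^bsub>G\<^esub> \<one>\<^bsub>G\<^esub> \<otimes>\<^bsub>G\<^esub> x)"
        using x fin by (intro R.add.finprod_singleton_swap) (auto simp: closed[OF f])
      finally show "(\<one>\<^bsub>?A\<^esub> \<otimes>\<^bsub>?A\<^esub> f) x = f x" using x by simp
    qed (use f mult_closed one_closed in auto)
    show "f \<otimes>\<^bsub>?A\<^esub> \<one>\<^bsub>?A\<^esub> = f"
    proof (rule ext)
      fix x assume x: "x \<in> carrier G"
      have eq: "inv\<^bsub>G\<^esub> y \<otimes>\<^bsub>G\<^esub> x = \<one>\<^bsub>G\<^esub> \<longleftrightarrow> y = x" if "y \<in> carrier G" for y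
        using x that by (metis G.inv_closed G.inv_equality G.inv_inv G.l_inv)
      have "(f \<otimes>\<^bsub>?A\<^esub> \<one>\<^bsub>?A\<^esub>) x = (\<Oplus>y\<in>carrier G. if y = x then f y else \<zero>)"
        unfolding mult[OF x] using x by (intro R.finsum_cong') (auto simp: one eq closed[OF f])
      also have "\<dots> = f x"
        using x fin by (intro R.add.finprod_singleton_swap) (auto simp: closed[OF f])
      finally show "(f \<otimes>\<^bsub>?A\<^esub> \<one>\<^bsub>?A\<^esub>) x = f x" .
    qed (use f mult_closed one_closed in auto)
  next
    fix f g h assume f: "f \<in> carrier ?A" and g: "g \<in> carrier ?A" and h: "h \<in> carrier ?A"
    note cl = closed[OF f] closed[OF g] closed[OF h]
    show "f \<otimes>\<^bsub>?A\<^esub> g \<otimes>\<^bsub>?A\<^esub> h = f \<otimes>\<^bsub>?A\<^esub> (g \<otimes>\<^bsub>?A\<^esub> h)"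
    proof (rule ext)
      fix x assume x: "x \<in> carrier G"
      have "(f \<otimes>\<^bsub>?A\<^esub> g \<otimes>\<^bsub>?A\<^esub> h) x =
            (\<Oplus>y\<in>carrier G. (\<Oplus>z\<in>carrier G. f z \<otimes> g (inv\<^bsub>G\<^esub> z \<otimes>\<^bsub>G\<^esub> y)) \<otimes> h (inv\<^bsub>G\<^esub> y \<otimes>\<^bsub>G\<^esub> x))"
        unfolding mult[OF x] using x
        by (intro R.finsum_cong') (auto simp: mult cl intro!: R.finsum_closed)
      also have "\<dots> = (\<Oplus>y\<in>carrier G. \<Oplus>z\<in>carrier G.
                        f z \<otimes> g (inv\<^bsub>G\<^esub> z \<otimes>\<^bsub>G\<^esub> y) \<otimes> h (inv\<^bsub>G\<^esub> y \<otimes>\<^bsub>G\<^esub> x))"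
        using x fin by (intro R.finsum_cong') (auto simp: cl intro!: R.finsum_closed R.finsum_ldistr)
      also have "\<dots> = (\<Oplus>z\<in>carrier G. \<Oplus>y\<in>carrier G.
                        f z \<otimes> g (inv\<^bsub>G\<^esub> z \<otimes>\<^bsub>G\<^esub> y) \<otimes> h (inv\<^bsub>G\<^esub> y \<otimes>\<^bsub>G\<^esub> x))"
        using x fin by (intro R.finsum_swap) (auto simp: cl)
      also have "\<dots> = (\<Oplus>z\<in>carrier G. f z \<otimes> (g \<otimes>\<^bsub>?A\<^esub> h) (inv\<^bsub>G\<^esub> z \<otimes>\<^bsub>G\<^esub> x))"
      proof (rule R.finsum_cong')
        fix z assume z: "z \<in> carrier G"
        let ?F = "\<lambda>y. f z \<otimes> g (inv\<^bsub>G\<^esub> z \<otimes>\<^bsub>G\<^esub> y) \<otimes> h (inv\<^bsub>G\<^esub> y \<otimes>\<^bsub>G\<^esub> x)"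
        have "finsum R ?F ((\<lambda>w. z \<otimes>\<^bsub>G\<^esub> w) ` carrier G) = (\<Oplus>w\<in>carrier G. ?F (z \<otimes>\<^bsub>G\<^esub> w))"
          using x z G.bij_betw_mult_left[OF z] by (intro R.finsum_reindex) (auto simp: cl)
        then have "finsum R ?F (carrier G) = (\<Oplus>w\<in>carrier G. ?F (z \<otimes>\<^bsub>G\<^esub> w))"
          using G.bij_betw_mult_left[OF z] by simp
        also have "\<dots> = (\<Oplus>w\<in>carrier G. f z \<otimes> (g w \<otimes> h (inv\<^bsub>G\<^esub> w \<otimes>\<^bsub>G\<^esub> (inv\<^bsub>G\<^esub> z \<otimes>\<^bsub>G\<^esub> x))))"
        proof (rule R.finsum_cong')
          fix w assume w: "w \<in> carrier G"
          have "inv\<^bsub>G\<^esub> z \<otimes>\<^bsub>G\<^esub> (z \<otimes>\<^bsub>G\<^esub> w) = w"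
            using w z by (simp add: G.m_assoc[symmetric])
          then show "?F (z \<otimes>\<^bsub>G\<^esub> w) = f z \<otimes> (g w \<otimes> h (inv\<^bsub>G\<^esub> w \<otimes>\<^bsub>G\<^esub> (inv\<^bsub>G\<^esub> z \<otimes>\<^bsub>G\<^esub> x)))"
            using x z w by (simp add: cl G.inv_mult_group G.m_assoc R.m_assoc)
        qed (use x z in \<open>auto simp: cl\<close>)
        also have "\<dots> = f z \<otimes> (\<Oplus>w\<in>carrier G. g w \<otimes> h (inv\<^bsub>G\<^esub> w \<otimes>\<^bsub>G\<^esub> (inv\<^bsub>G\<^esub> z \<otimes>\<^bsub>G\<^esub> x)))"
          using x z fin by (intro R.finsum_rdistr[symmetric]) (auto simp: cl)
        finally show "finsum R ?F (carrier G) = f z \<otimes> (g \<otimes>\<^bsub>?A\<^esub> h) (inv\<^bsub>G\<^esub> z \<otimes>\<^bsub>G\<^esub> x)"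
          using x z by (simp add: mult)
      qed (use x closed[OF mult_closed[OF g h]] cl in auto)
      finally show "(f \<otimes>\<^bsub>?A\<^esub> g \<otimes>\<^bsub>?A\<^esub> h) x = (f \<otimes>\<^bsub>?A\<^esub> (g \<otimes>\<^bsub>?A\<^esub> h)) x"
        by (simp add: mult[OF x])
    qed (use f g h mult_closed in auto)
  qed (use mult_closed one_closed in auto)
  show ?thesis
  proof (rule ringI[OF ab mon])
    fix f g h assume f: "f \<in> carrier ?A" and g: "g \<in> carrier ?A" and h: "h \<in> carrier ?A"
    note cl = closed[OF f] closed[OF g] closed[OF h]
    show "(f \<oplus>\<^bsub>?A\<^esub> g) \<otimes>\<^bsub>?A\<^esub> h = f \<otimes>\<^bsub>?A\<^esub> h \<oplus>\<^bsub>?A\<^esub> g \<otimes>\<^bsub>?A\<^esub> h"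
    proof (rule ext)
      fix x assume x: "x \<in> carrier G"
      have "((f \<oplus>\<^bsub>?A\<^esub> g) \<otimes>\<^bsub>?A\<^esub> h) x =
            (\<Oplus>y\<in>carrier G. f y \<otimes> h (inv\<^bsub>G\<^esub> y \<otimes>\<^bsub>G\<^esub> x) \<oplus> g y \<otimes> h (inv\<^bsub>G\<^esub> y \<otimes>\<^bsub>G\<^esub> x))"
        unfolding mult[OF x] using x by (intro R.finsum_cong') (auto simp: add cl R.l_distr)
      also have "\<dots> = (f \<otimes>\<^bsub>?A\<^esub> h) x \<oplus> (g \<otimes>\<^bsub>?A\<^esub> h) x"
        unfolding mult[OF x] using x by (intro R.finsum_addf) (auto simp: cl)
      finally show "((f \<oplus>\<^bsub>?A\<^esub> g) \<otimes>\<^bsub>?A\<^esub> h) x = (f \<otimes>\<^bsub>?A\<^esub> h \<oplus>\<^bsub>?A\<^esub> g \<otimes>\<^bsub>?A\<^esub> h) x"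
        using x by (simp add: add)
    qed (use f g h mult_closed add_closed in auto)
    show "h \<otimes>\<^bsub>?A\<^esub> (f \<oplus>\<^bsub>?A\<^esub> g) = h \<otimes>\<^bsub>?A\<^esub> f \<oplus>\<^bsub>?A\<^esub> h \<otimes>\<^bsub>?A\<^esub> g"
    proof (rule ext)
      fix x assume x: "x \<in> carrier G"
      have "(h \<otimes>\<^bsub>?A\<^esub> (f \<oplus>\<^bsub>?A\<^esub> g)) x =
            (\<Oplus>y\<in>carrier G. h y \<otimes> f (inv\<^bsub>G\<^esub> y \<otimes>\<^bsub>G\<^esub> x) \<oplus> h y \<otimes> g (inv\<^bsub>G\<^esub> y \<otimes>\<^bsub>G\<^esub> x))"
        unfolding mult[OF x] using x by (intro R.finsum_cong') (auto simp: add cl R.r_distr)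
      also have "\<dots> = (h \<otimes>\<^bsub>?A\<^esub> f) x \<oplus> (h \<otimes>\<^bsub>?A\<^esub> g) x"
        unfolding mult[OF x] using x by (intro R.finsum_addf) (auto simp: cl)
      finally show "(h \<otimes>\<^bsub>?A\<^esub> (f \<oplus>\<^bsub>?A\<^esub> g)) x = (h \<otimes>\<^bsub>?A\<^esub> f \<oplus>\<^bsub>?A\<^esub> h \<otimes>\<^bsub>?A\<^esub> g) x"
        using x by (simp add: add)
    qed (use f g h mult_closed add_closed in auto)
  qed
qed

lemma ring_sym_algebra: "cring R \<Longrightarrow> ring (sym_algebra R n)"
  by (intro ring_group_algebra sym_group_is_group)
     (auto simp: sym_group_def finite_permutations)

lemma group_algebra_of_closed:
  "ring R \<Longrightarrow> group_algebra_of R G p \<in> carrier (group_algebra R G)"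
  by (auto simp: group_algebra_def group_algebra_of_def ring.ring_simprules)

lemma group_algebra_of_mult:
  fixes R (structure)
  assumes "cring R" "group G" "finite (carrier G)" "p \<in> carrier G" "q \<in> carrier G"
  shows "group_algebra_of R G p \<otimes>\<^bsub>group_algebra R G\<^esub> group_algebra_of R G q
         = group_algebra_of R G (p \<otimes>\<^bsub>G\<^esub> q)"
proof
  interpret R: cring R by fact
  interpret G: group G by fact
  fix x
  show "(group_algebra_of R G p \<otimes>\<^bsub>group_algebra R G\<^esub> group_algebra_of R G q) x
         = group_algebra_of R G (p \<otimes>\<^bsub>G\<^esub> q) x"
  proof (cases "x \<in> carrier G")
    case x: True
    have eq: "inv\<^bsub>G\<^esub> p \<otimes>\<^bsub>G\<^esub> x = q \<longleftrightarrow> x = p \<otimes>\<^bsub>G\<^esub> q"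
      using x assms(4,5) by (metis G.inv_closed G.inv_solve_left)
    have "(group_algebra_of R G p \<otimes>\<^bsub>group_algebra R G\<^esub> group_algebra_of R G q) x
          = (\<Oplus>y\<in>carrier G. if y = p then (if inv\<^bsub>G\<^esub> y \<otimes>\<^bsub>G\<^esub> x = q then \<one> else \<zero>) else \<zero>)"
      using x unfolding group_algebra_def group_algebra_of_def
      by (auto intro!: R.finsum_cong')
    also have "\<dots> = (if inv\<^bsub>G\<^esub> p \<otimes>\<^bsub>G\<^esub> x = q then \<one> else \<zero>)"
      using assms by (intro R.add.finprod_singleton_swap) auto
    finally show ?thesis
      using x eq by (simp add: group_algebra_of_def)
  next
    case False
    then show ?thesis
      by (simp add: group_algebra_def group_algebra_of_def)
  qed
qed

lemma cycle_upt_in_sym_group: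
  assumes "1 \<le> l" "i \<le> n"
  shows "cycle_of_list [l..<Suc i] \<in> carrier (sym_group n)"
  unfolding sym_group_carrier
  by (rule permutes_subset[OF cycle_permutes]) (use assms in auto)

end

theory Submission
  imports Defs
begin

text \<open>
  Write \<open>b = t\<^sub>j\<close>, \<open>s = (j - 1, j)\<close> and \<open>\<tau>\<^sub>p = (p, j)\<close>. Since \<open>b\<close> commutes with \<open>S\<^bsub>j - 1\<^esub>\<close>,
  one gets \<open>[t\<^sub>l, b] = w\<^sub>l [s, b] b\<close> with \<open>w\<^sub>l\<close> the cycle \<open>l, \<dots>, j - 1\<close>. Let \<open>U\<^sub>p\<close> be the right ideal
  of all \<open>u\<close> with \<open>\<tau>\<^sub>p b u = b u\<close>. The relation \<open>\<tau>\<^sub>p b (1 + \<tau>\<^sub>p b) = b (1 + \<tau>\<^sub>p b)\<close>, a conjugate of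
  \<open>s t\<^sub>j t\<^bsub>j - 1\<^esub> = t\<^sub>j t\<^bsub>j - 1\<^esub>\<close>, shows that \<open>b [s, b] b\<close> is fixed by \<open>s\<close>, hence \<open>[t\<^sub>l, b] \<in> U\<^sub>l\<close>;
  it also shows that \<open>u \<in> U\<^sub>p\<close> implies \<open>b u \<in> U\<^sub>p\<close>. For \<open>u \<in> U\<^sub>p\<close> and \<open>l \<le> p\<close> it follows that
  \<open>[t\<^sub>l, b] u\<close> is \<open>0\<close> if \<open>p = j - 1\<close> and lies in \<open>U\<^bsub>p + 1\<^esub>\<close> otherwise. So each further factor
  raises the index of the ideal until the product vanishes.
\<close>

text \<open>Turns the product of two shuffles into one sum over pairs of cycles, which an involution
  can then reindex.\<close>

lemma (in abelian_monoid) finsum_cartesian: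
  assumes "finite X" "finite Y" "\<And>x y. x \<in> X \<Longrightarrow> y \<in> Y \<Longrightarrow> f x y \<in> carrier G"
  shows "(\<Oplus>x\<in>X. \<Oplus>y\<in>Y. f x y) = (\<Oplus>z\<in>X \<times> Y. f (fst z) (snd z))"
  using assms(1,3)
proof (induction X rule: finite_induct)
  case (insert x X)
  have "(\<Oplus>z\<in>{x} \<times> Y. f (fst z) (snd z)) = (\<Oplus>z\<in>Pair x ` Y. f (fst z) (snd z))"
    by (rule arg_cong[where f = "finsum G _"]) auto
  also have "\<dots> = (\<Oplus>y\<in>Y. f x y)"
    using insert.prems by (subst finsum_reindex) (auto simp: inj_on_def)
  finally have "(\<Oplus>z\<in>insert x X \<times> Y. f (fst z) (snd z)) =
      (\<Oplus>y\<in>Y. f x y) \<oplus> (\<Oplus>z\<in>X \<times> Y. f (fst z) (snd z))"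
    using insert.hyps insert.prems assms(2)
    by (subst Sigma_Un_distrib1[of "{x}" X, simplified], subst finsum_Un_disjoint) auto
  also have "\<dots> = (\<Oplus>x\<in>insert x X. \<Oplus>y\<in>Y. f x y)"
    using insert by (subst finsum_insert) (auto intro!: finsum_closed)
  finally show ?case by simp
qed simp

section \<open>Products of commutators in a ring with the shuffle relations\<close>

text \<open>Isolates the identities from which the vanishing follows by ring calculations alone. In
  the application \<open>\<rho> p\<close> is the transposition \<open>(p, j - 1)\<close> and
  \<open>C l\<close> is the commutator of \<open>t l\<close> with \<open>t j\<close>.\<close>

locale shuffle_relations = ring A for A (structure) +
  fixes j :: nat and b :: 'a and \<tau> \<rho> w C :: "nat \<Rightarrow> 'a"
  assumes b_closed: "b \<in> carrier A"
    and tau_closed: "\<And>p. p \<in> {1..<j} \<Longrightarrow> \<tau> p \<in> carrier A"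
    and rho_closed: "\<And>p. p \<in> {1..<j - 1} \<Longrightarrow> \<rho> p \<in> carrier A"
    and w_closed: "\<And>l. l \<in> {1..<j} \<Longrightarrow> w l \<in> carrier A"
    and tau_fix: "\<And>p. p \<in> {1..<j} \<Longrightarrow>
          \<tau> p \<otimes> (b \<oplus> b \<otimes> (\<tau> p \<otimes> b)) = b \<oplus> b \<otimes> (\<tau> p \<otimes> b)"
    and rho_comm: "\<And>p. p \<in> {1..<j - 1} \<Longrightarrow> \<rho> p \<otimes> b = b \<otimes> \<rho> p"
    and rho_tau: "\<And>p. p \<in> {1..<j - 1} \<Longrightarrow> \<rho> p \<otimes> \<tau> (j - 1) = \<tau> (j - 1) \<otimes> \<tau> p"
    and tau_conj: "\<And>p. p \<in> {1..<j - 1} \<Longrightarrow> \<tau> (j - 1) \<otimes> (\<rho> p \<otimes> \<tau> (j - 1)) = \<tau> p"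
    and w_comm: "\<And>l. l \<in> {1..<j} \<Longrightarrow> w l \<otimes> b = b \<otimes> w l"
    and tau_w: "\<And>l. l \<in> {1..<j} \<Longrightarrow> \<tau> l \<otimes> w l = w l \<otimes> \<tau> (j - 1)"
    and tau_Suc_w: "\<And>l p. 1 \<le> l \<Longrightarrow> l \<le> p \<Longrightarrow> p < j - 1 \<Longrightarrow> \<tau> (Suc p) \<otimes> w l = w l \<otimes> \<tau> p"
    and C_less: "\<And>l. l \<in> {1..<j} \<Longrightarrow>
          C l = w l \<otimes> ((\<tau> (j - 1) \<otimes> b \<ominus> b \<otimes> \<tau> (j - 1)) \<otimes> b)"
    and C_eq: "C j = \<zero>"
begin

definition s :: 'a where "s = \<tau> (j - 1)"

text \<open>Multiply \<open>tau_fix\<close> by \<open>u\<close> on the right. The hypothesis turns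
  each \<open>\<tau> p b u\<close> into \<open>b u\<close>, and the common summand
  \<open>b u\<close> cancels.\<close>

lemma tau_fix_b_mult:
  assumes p: "p \<in> {1..<j}" and u: "u \<in> carrier A" and fx: "\<tau> p \<otimes> (b \<otimes> u) = b \<otimes> u"
  shows "\<tau> p \<otimes> (b \<otimes> (b \<otimes> u)) = b \<otimes> (b \<otimes> u)"
proof -
  note cl = b_closed tau_closed[OF p] u
  have "\<tau> p \<otimes> (b \<otimes> u) \<oplus> \<tau> p \<otimes> (b \<otimes> (\<tau> p \<otimes> (b \<otimes> u)))
      = b \<otimes> u \<oplus> b \<otimes> (\<tau> p \<otimes> (b \<otimes> u))"
    using arg_cong[OF tau_fix[OF p], of "\<lambda>x. x \<otimes> u"] cl by (simp add: m_assoc l_distr r_distr)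
  then show ?thesis
    using cl by (simp add: fx)
qed

lemma s_closed: "j \<ge> 2 \<Longrightarrow> s \<in> carrier A"
  unfolding s_def by (intro tau_closed) auto

text \<open>By \<open>tau_fix\<close>, \<open>s b s b = b + b s b - s b\<close> (this is
  \<open>K\<close>). It shows that left multiplication by \<open>s\<close> adds the same error
  \<open>b b - s b b\<close> to both \<open>b s b b\<close> and \<open>b b s b\<close>, so their
  difference is fixed.\<close>

lemma s_fix_commutator:
  assumes "j \<ge> 2"
  shows "s \<otimes> (b \<otimes> ((s \<otimes> b \<ominus> b \<otimes> s) \<otimes> b)) = b \<otimes> ((s \<otimes> b \<ominus> b \<otimes> s) \<otimes> b)"
proof -
  note cl = b_closed s_closed[OF assms]
  have fx: "s \<otimes> (b \<oplus> b \<otimes> (s \<otimes> b)) = b \<oplus> b \<otimes> (s \<otimes> b)"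
    unfolding s_def using assms by (intro tau_fix) auto
  have "s \<otimes> (b \<otimes> (s \<otimes> b)) = s \<otimes> (b \<oplus> b \<otimes> (s \<otimes> b)) \<ominus> s \<otimes> b"
    using cl by algebra
  then have K: "s \<otimes> (b \<otimes> (s \<otimes> b)) = b \<oplus> b \<otimes> (s \<otimes> b) \<ominus> s \<otimes> b"
    by (simp only: fx)
  have "s \<otimes> (b \<otimes> (s \<otimes> (b \<otimes> b))) = s \<otimes> (b \<otimes> (s \<otimes> b)) \<otimes> b"
    using cl by algebra
  also have "\<dots> = b \<otimes> b \<oplus> b \<otimes> (s \<otimes> (b \<otimes> b)) \<ominus> s \<otimes> (b \<otimes> b)"
    unfolding K using cl by algebra
  finally have 1: "s \<otimes> (b \<otimes> (s \<otimes> (b \<otimes> b))) = \<dots>" .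
  \<comment> \<open>\<open>K\<close> multiplied by \<open>b\<close> on the left and solved for
    \<open>b b s b\<close>: after left multiplication by \<open>s\<close> the right-hand side
    contains words to which \<open>K\<close> applies again.\<close>
  have bK: "b \<otimes> (b \<otimes> (s \<otimes> b)) = b \<otimes> (s \<otimes> (b \<otimes> (s \<otimes> b))) \<oplus> b \<otimes> (s \<otimes> b) \<ominus> b \<otimes> b"
    unfolding K using cl by algebra
  \<comment> \<open>Only the leftmost \<open>s b s b\<close> is expanded; the others are kept, one
    to cancel and one to be absorbed by \<open>bK\<close>.\<close>
  have sbsbsb: "s \<otimes> (b \<otimes> (s \<otimes> b)) \<otimes> (s \<otimes> b) =
      b \<otimes> (s \<otimes> b) \<oplus> b \<otimes> (s \<otimes> (b \<otimes> (s \<otimes> b))) \<ominus> s \<otimes> (b \<otimes> (s \<otimes> b))"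
    by (subst K) (use cl in algebra)
  have "s \<otimes> (b \<otimes> (b \<otimes> (s \<otimes> b))) =
      s \<otimes> (b \<otimes> (s \<otimes> b)) \<otimes> (s \<otimes> b) \<oplus> s \<otimes> (b \<otimes> (s \<otimes> b)) \<ominus> s \<otimes> (b \<otimes> b)"
    unfolding bK using cl by algebra
  also have "\<dots> = b \<otimes> (s \<otimes> b) \<oplus> b \<otimes> (s \<otimes> (b \<otimes> (s \<otimes> b)))
      \<ominus> s \<otimes> (b \<otimes> (s \<otimes> b)) \<oplus> s \<otimes> (b \<otimes> (s \<otimes> b)) \<ominus> s \<otimes> (b \<otimes> b)"
    unfolding sbsbsb ..
  also have "\<dots> = b \<otimes> (b \<otimes> (s \<otimes> b)) \<oplus> b \<otimes> b \<ominus> s \<otimes> (b \<otimes> b)"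
    unfolding bK using cl by algebra
  finally have 2: "s \<otimes> (b \<otimes> (b \<otimes> (s \<otimes> b))) = \<dots>" .
  have "s \<otimes> (b \<otimes> ((s \<otimes> b \<ominus> b \<otimes> s) \<otimes> b)) =
      s \<otimes> (b \<otimes> (s \<otimes> (b \<otimes> b))) \<ominus> s \<otimes> (b \<otimes> (b \<otimes> (s \<otimes> b)))"
    using cl by algebra
  also have "\<dots> = b \<otimes> ((s \<otimes> b \<ominus> b \<otimes> s) \<otimes> b)"
    unfolding 1 2 using cl by algebra
  finally show ?thesis .
qed

text \<open>The filtration climbed by the commutators: each factor \<open>C l\<close> raises the level
  by at least one, and level \<open>j\<close> is zero.\<close>

definition level :: "nat \<Rightarrow> 'a set" where
  "level p = {u \<in> carrier A. if p < j then \<tau> p \<otimes> (b \<otimes> u) = b \<otimes> u else u = \<zero>}"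

lemma C_closed:
  assumes "l \<in> {1..j}"
  shows "C l \<in> carrier A"
proof (cases "l = j")
  case False
  then have l: "l \<in> {1..<j}" and j: "j \<ge> 2" using assms by auto
  show ?thesis
    unfolding C_less[OF l, folded s_def] using b_closed s_closed[OF j] w_closed[OF l] by simp
qed (simp add: C_eq)

text \<open>As \<open>w l\<close> commutes with \<open>b\<close>, \<open>b C l u\<close> equals
  \<open>w l x u\<close> with \<open>x = b [s, b] b\<close>. Moving \<open>\<tau> l\<close> past
  \<open>w l\<close> turns it into \<open>s\<close>, which fixes \<open>x\<close>.\<close>

lemma C_mult_level_self:
  assumes l: "l \<in> {1..j}" and u: "u \<in> carrier A"
  shows "C l \<otimes> u \<in> level l"
proof (cases "l < j")
  case True
  then have l': "l \<in> {1..<j}" and j: "j \<ge> 2" using l by auto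
  note cl = b_closed s_closed[OF j] w_closed[OF l'] tau_closed[OF l'] u
  define x where "x = b \<otimes> ((s \<otimes> b \<ominus> b \<otimes> s) \<otimes> b)"
  have x: "x \<in> carrier A" unfolding x_def using cl by simp
  have "b \<otimes> (C l \<otimes> u) = b \<otimes> w l \<otimes> ((s \<otimes> b \<ominus> b \<otimes> s) \<otimes> b) \<otimes> u"
    unfolding C_less[OF l', folded s_def] using cl by (simp add: m_assoc)
  also have "\<dots> = w l \<otimes> (x \<otimes> u)"
    unfolding w_comm[OF l', symmetric] x_def using cl by (simp add: m_assoc)
  finally have bC: "b \<otimes> (C l \<otimes> u) = w l \<otimes> (x \<otimes> u)" .
  have "\<tau> l \<otimes> (w l \<otimes> (x \<otimes> u)) = \<tau> l \<otimes> w l \<otimes> (x \<otimes> u)"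
    using cl x by (simp add: m_assoc)
  also have "\<dots> = w l \<otimes> (s \<otimes> x \<otimes> u)"
    unfolding tau_w[OF l', folded s_def] using cl x by (simp add: m_assoc)
  also have "s \<otimes> x = x"
    unfolding x_def by (rule s_fix_commutator[OF j])
  finally show ?thesis
    using True bC C_closed[OF l] u by (simp add: level_def)
next
  case False
  then show ?thesis using l u by (simp add: level_def C_eq)
qed

text \<open>Here \<open>\<tau> p\<close> fixes both \<open>b u\<close> and \<open>b b u\<close>. For
  \<open>p = j - 1\<close> it equals \<open>s\<close>, so both terms of \<open>[s, b] b u\<close>
  become \<open>b b u\<close> and cancel. Otherwise \<open>y = b [s, b] b u\<close> is fixed by
  \<open>s\<close> and by \<open>\<rho> p\<close>, hence by \<open>\<tau> p = s \<rho> p s\<close>,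
  and \<open>w l\<close> carries \<open>\<tau> p\<close> to \<open>\<tau> (Suc p)\<close>.\<close>

lemma C_mult_level_Suc:
  assumes l: "1 \<le> l" "l \<le> p" "p < j" and u: "u \<in> level p"
  shows "C l \<otimes> u \<in> level (Suc p)"
proof -
  have l': "l \<in> {1..<j}" and p: "p \<in> {1..<j}" and j: "j \<ge> 2" using l by auto
  have uc: "u \<in> carrier A" and fx: "\<tau> p \<otimes> (b \<otimes> u) = b \<otimes> u"
    using u l by (auto simp: level_def)
  note fix_b = tau_fix_b_mult[OF p uc fx]
  note cl = b_closed s_closed[OF j] w_closed[OF l'] tau_closed[OF p] uc
  have Cu: "C l \<otimes> u = w l \<otimes> (s \<otimes> (b \<otimes> (b \<otimes> u)) \<ominus> b \<otimes> (s \<otimes> (b \<otimes> u)))"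
    unfolding C_less[OF l', folded s_def] using cl by algebra
  show ?thesis
  proof (cases "p = j - 1")
    case True
    then have "C l \<otimes> u = \<zero>"
      unfolding Cu using True fx fix_b cl by (simp add: s_def minus_eq r_neg)
    then show ?thesis using True by (simp add: level_def)
  next
    case False
    then have p': "p \<in> {1..<j - 1}" using p by auto
    note cl = cl rho_closed[OF p']
    define y where "y = b \<otimes> (s \<otimes> (b \<otimes> (b \<otimes> u))) \<ominus> b \<otimes> (b \<otimes> (s \<otimes> (b \<otimes> u)))"
    have y: "y \<in> carrier A" unfolding y_def using cl by simp
    have "y = b \<otimes> ((s \<otimes> b \<ominus> b \<otimes> s) \<otimes> b) \<otimes> u"
      unfolding y_def using cl by algebra
    then have sy: "s \<otimes> y = y"
      using s_fix_commutator[OF j] cl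
      by (metis (no_types, lifting) m_assoc m_closed minus_closed)
    have rho_s: "\<rho> p \<otimes> (b \<otimes> (s \<otimes> z)) = b \<otimes> (s \<otimes> (\<tau> p \<otimes> z))" if z: "z \<in> carrier A" for z
    proof -
      have "\<rho> p \<otimes> (b \<otimes> (s \<otimes> z)) = \<rho> p \<otimes> b \<otimes> (s \<otimes> z)" using cl z by (simp add: m_assoc)
      also have "\<dots> = b \<otimes> (\<rho> p \<otimes> s \<otimes> z)"
        unfolding rho_comm[OF p'] using cl z by (simp add: m_assoc)
      finally show ?thesis
        unfolding rho_tau[OF p', folded s_def] using cl z by (simp add: m_assoc)
    qed
    have "\<rho> p \<otimes> (b \<otimes> (b \<otimes> (s \<otimes> (b \<otimes> u)))) = \<rho> p \<otimes> b \<otimes> (b \<otimes> (s \<otimes> (b \<otimes> u)))"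
      using cl by (simp add: m_assoc)
    also have "\<dots> = b \<otimes> (\<rho> p \<otimes> (b \<otimes> (s \<otimes> (b \<otimes> u))))"
      unfolding rho_comm[OF p'] using cl by (simp add: m_assoc)
    also have "\<dots> = b \<otimes> (b \<otimes> (s \<otimes> (b \<otimes> u)))"
      using rho_s[of "b \<otimes> u"] fx cl by simp
    finally have rho_y: "\<rho> p \<otimes> y = y"
      unfolding y_def using rho_s[of "b \<otimes> (b \<otimes> u)"] fix_b cl
      by (simp add: r_distr minus_eq r_minus)
    have "\<tau> p \<otimes> y = s \<otimes> (\<rho> p \<otimes> (s \<otimes> y))"
      unfolding tau_conj[OF p', folded s_def, symmetric] using cl y by (simp add: m_assoc)
    then have tau_y: "\<tau> p \<otimes> y = y" by (simp add: sy rho_y)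
    have "b \<otimes> (C l \<otimes> u) = b \<otimes> w l \<otimes> (s \<otimes> (b \<otimes> (b \<otimes> u)) \<ominus> b \<otimes> (s \<otimes> (b \<otimes> u)))"
      unfolding Cu using cl by (simp add: m_assoc)
    also have "\<dots> = w l \<otimes> y"
      unfolding w_comm[OF l', symmetric] y_def using cl by algebra
    finally have bC: "b \<otimes> (C l \<otimes> u) = w l \<otimes> y" .
    have sp: "\<tau> (Suc p) \<in> carrier A" using p' by (intro tau_closed) auto
    have "\<tau> (Suc p) \<otimes> (w l \<otimes> y) = \<tau> (Suc p) \<otimes> w l \<otimes> y"
      using cl y sp by (simp add: m_assoc)
    also have "\<tau> (Suc p) \<otimes> w l = w l \<otimes> \<tau> p"
      using l p' by (intro tau_Suc_w) auto
    also have "w l \<otimes> \<tau> p \<otimes> y = w l \<otimes> y"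
      using cl y tau_y by (simp add: m_assoc)
    finally show ?thesis
      using bC C_closed[of l] l uc p' by (auto simp: level_def)
  qed
qed

text \<open>If \<open>p < l\<close>, the factor reaches level \<open>l\<close> whatever
  \<open>u\<close> is; if \<open>l \<le> p < j\<close>, it climbs one step; from \<open>j\<close>
  on, \<open>u\<close> is already zero.\<close>

lemma C_mult_level:
  assumes l: "l \<in> {1..j}" and p: "1 \<le> p" and u: "u \<in> level p"
  shows "\<exists>q>p. C l \<otimes> u \<in> level q"
proof -
  have uc: "u \<in> carrier A" using u by (simp add: level_def)
  consider "p < l" | "l \<le> p" "p < j" | "j \<le> p" using l by fastforce
  then show ?thesis
  proof cases
    case 1
    then show ?thesis using C_mult_level_self[OF l uc] by blast
  next
    case 2
    then show ?thesis using C_mult_level_Suc[OF _ _ _ u] l by auto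
  next
    case 3
    then have "C l \<otimes> u \<in> level (Suc p)"
      using u C_closed[OF l] by (simp add: level_def)
    then show ?thesis by blast
  qed
qed

text \<open>The index reached stays existential because a factor may jump by more than one level and
  no inclusions between levels are used.\<close>

lemma foldr_C_level:
  assumes "set ls \<subseteq> {1..j}" "1 \<le> p" "u \<in> level p"
  shows "\<exists>q\<ge>p + length ls. foldr (\<otimes>) (map C ls) u \<in> level q"
  using assms(1)
proof (induction ls)
  case Nil
  then show ?case using assms by auto
next
  case (Cons l ls)
  then obtain q where q: "q \<ge> p + length ls" "foldr (\<otimes>) (map C ls) u \<in> level q" by auto
  then obtain r where "r > q" "C l \<otimes> foldr (\<otimes>) (map C ls) u \<in> level r"
    using C_mult_level[of l q] Cons.prems assms(2) by auto
  then show ?case using q by (intro exI[of _ r]) auto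
qed

text \<open>The rightmost factor starts at level \<open>l\<close>, and the \<open>length ls\<close>
  factors to its left climb to level \<open>j\<close> or beyond.\<close>

lemma foldr_C_eq_zero:
  assumes "set ls \<subseteq> {1..j}" "l \<in> {1..j}" "j \<le> l + length ls"
  shows "foldr (\<otimes>) (map C (ls @ [l])) \<one> = \<zero>"
proof -
  have "C l \<otimes> \<one> \<in> level l"
    using assms(2) by (intro C_mult_level_self) auto
  then obtain q where "q \<ge> l + length ls" "foldr (\<otimes>) (map C ls) (C l \<otimes> \<one>) \<in> level q"
    using foldr_C_level[OF assms(1), of l] assms(2) by auto
  then show ?thesis using assms(3) by (simp add: level_def)
qed

end

section \<open>Cycles of consecutive integers\<close>

text \<open>Peels the transposition of \<open>l\<close> and \<open>Suc l\<close> off the left. For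
  \<open>i < l\<close> the list is empty and the formula gives the identity.\<close>

lemma cycle_of_list_upt:
  "cycle_of_list [l..<Suc i] x =
     (if l \<le> x \<and> x < i then Suc x else if x = i \<and> l \<le> i then l else x)"
proof (induction "Suc i - l" arbitrary: l)
  case (Suc d)
  show ?case
  proof (cases "l = i")
    case False
    then have l: "l < i" using Suc(2) by linarith
    then have upt: "[l..<Suc i] = l # Suc l # [Suc (Suc l)..<Suc i]"
      and upt': "[Suc l..<Suc i] = Suc l # [Suc (Suc l)..<Suc i]"
      by (simp_all add: upt_conv_Cons del: upt_Suc)
    have "cycle_of_list [l..<Suc i] x = transpose l (Suc l) (cycle_of_list [Suc l..<Suc i] x)"
      unfolding upt upt' by (simp del: upt_Suc)
    also have "cycle_of_list [Suc l..<Suc i] x =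
        (if Suc l \<le> x \<and> x < i then Suc x else if x = i \<and> Suc l \<le> i then Suc l else x)"
      using Suc(2) by (intro Suc(1)) simp
    also have "transpose l (Suc l) \<dots> =
        (if l \<le> x \<and> x < i then Suc x else if x = i \<and> l \<le> i then l else x)"
      using l by (auto simp: transpose_def)
    finally show ?thesis .
  qed simp
qed simp

definition cyc :: "nat \<Rightarrow> nat \<Rightarrow> nat \<Rightarrow> nat" where
  "cyc l i = cycle_of_list [l..<Suc i]"

lemma cyc_apply:
  "cyc l i x = (if l \<le> x \<and> x < i then Suc x else if x = i \<and> l \<le> i then l else x)"
  unfolding cyc_def by (rule cycle_of_list_upt)

lemma cyc_permutes: "1 \<le> l \<Longrightarrow> i \<le> n \<Longrightarrow> cyc l i permutes {1..n}"
  unfolding cyc_def using cycle_upt_in_sym_group sym_group_carrier by blast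

lemma cyc_refl: "cyc l l = id"
  by (auto simp: cyc_apply)

text \<open>Cutting the cycle at \<open>j\<close> leaves a cycle below \<open>j\<close>, a linking
  transposition, and a summand of \<open>t j\<close>.\<close>

lemma cyc_split:
  assumes "l < j" "j \<le> i"
  shows "cyc l i = cyc l (j - 1) \<circ> transpose (j - 1) j \<circ> cyc j i"
proof
  fix x
  consider "x < l" | "l \<le> x" "x < j - 1" | "x = j - 1" | "j \<le> x" "x < i" | "x = i" | "i < x"
    using assms by linarith
  then show "cyc l i x = (cyc l (j - 1) \<circ> transpose (j - 1) j \<circ> cyc j i) x"
    by cases (use assms in \<open>auto simp: cyc_apply transpose_def\<close>)
qed

text \<open>The supports are disjoint: \<open>p\<close> moves only points below \<open>j\<close>,
  the cycle only points from \<open>j\<close> on.\<close>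

lemma permutes_commute_cyc:
  assumes "p permutes {1..<j}"
  shows "p \<circ> cyc j i = cyc j i \<circ> p"
proof
  fix x
  have out: "p y = y" if "j \<le> y" for y
    using assms that by (auto simp: permutes_def)
  show "(p \<circ> cyc j i) x = (cyc j i \<circ> p) x"
  proof (cases "x < j")
    case True
    \<comment> \<open>The point \<open>x = 0\<close> lies outside \<open>{1..<j}\<close> and is
      fixed by \<open>p\<close>.\<close>
    have "p x < j"
      using permutes_in_image[OF assms, of x] assms True
      by (cases "x \<in> {1..<j}") (auto simp: permutes_not_in)
    then show ?thesis using True by (auto simp: cyc_apply)
  next
    case False
    then show ?thesis using out by (auto simp: cyc_apply)
  qed
qed

text \<open>An involution on the pairs of cycles in \<open>t (q + 1) t q\<close>; it is what makes this product
  invariant under left multiplication by the transposition of \<open>q\<close> and \<open>q + 1\<close>.\<close>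

lemma cyc_exchange:
  assumes "q \<le> i" "i < i'"
  shows "transpose q (Suc q) \<circ> (cyc (Suc q) (Suc i) \<circ> cyc q i') = cyc (Suc q) i' \<circ> cyc q i"
proof
  fix x
  consider "x < q" | "q \<le> x" "x < i" | "x = i" | "i < x" "x < i'" | "x = i'" | "i' < x"
    using assms by linarith
  then show "(transpose q (Suc q) \<circ> (cyc (Suc q) (Suc i) \<circ> cyc q i')) x =
      (cyc (Suc q) i' \<circ> cyc q i) x"
    by cases (use assms in \<open>simp_all add: cyc_apply transpose_def\<close>)
qed

text \<open>The same pairing read backwards, since the transposition is its own inverse.\<close>

lemma cyc_exchange':
  assumes "q \<le> i'" "i' < i"
  shows "transpose q (Suc q) \<circ> (cyc (Suc q) i \<circ> cyc q i') = cyc (Suc q) (Suc i') \<circ> cyc q i"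
  unfolding cyc_exchange[OF assms, symmetric] by (simp add: comp_assoc[symmetric])

lemma inj_comp_transpose:
  assumes "inj f"
  shows "f \<circ> transpose x y = transpose (f x) (f y) \<circ> f"
  using assms by (auto simp: fun_eq_iff transpose_def inj_eq)

lemma inj_cyc: "1 \<le> l \<Longrightarrow> inj (cyc l i)"
  by (rule permutes_inj[OF cyc_permutes[OF _ order_refl]])

section \<open>Shuffles in the group algebra of the symmetric group\<close>

locale sym_algebra_cring = cring R for R (structure) +
  fixes n :: nat
begin

abbreviation "A \<equiv> sym_algebra R n"

sublocale A: ring A
  using ring_sym_algebra is_cring .

definition e :: "(nat \<Rightarrow> nat) \<Rightarrow> (nat \<Rightarrow> nat) \<Rightarrow> 'a" where
  "e = group_algebra_of R (sym_group n)"

abbreviation t :: "nat \<Rightarrow> (nat \<Rightarrow> nat) \<Rightarrow> 'a" where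
  "t \<equiv> somewhere_to_below R n"

lemma e_closed [simp]: "e p \<in> carrier A"
  unfolding e_def by (rule group_algebra_of_closed) (rule ring_axioms)

lemma e_mult:
  assumes "p permutes {1..n}" "q permutes {1..n}"
  shows "e p \<otimes>\<^bsub>A\<^esub> e q = e (p \<circ> q)"
  using group_algebra_of_mult[OF is_cring sym_group_is_group, of n p q] assms
  by (simp add: e_def sym_group_mult sym_group_carrier)
    (simp add: sym_group_def finite_permutations)

lemma e_id: "e id = \<one>\<^bsub>A\<^esub>"
  by (auto simp: e_def group_algebra_of_def group_algebra_def sym_group_one)

lemma t_eq: "t l = (\<Oplus>\<^bsub>A\<^esub>i\<in>{l..n}. e (cyc l i))"
  by (simp add: somewhere_to_below_def e_def cyc_def)

lemma t_closed [simp]: "t l \<in> carrier A"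
  unfolding t_eq by (intro A.finsum_closed) auto

lemma e_mult_sum:
  assumes "p permutes {1..n}" "\<And>i. i \<in> I \<Longrightarrow> f i permutes {1..n}" "finite I"
  shows "e p \<otimes>\<^bsub>A\<^esub> (\<Oplus>\<^bsub>A\<^esub>i\<in>I. e (f i)) = (\<Oplus>\<^bsub>A\<^esub>i\<in>I. e (p \<circ> f i))"
proof -
  have "e p \<otimes>\<^bsub>A\<^esub> (\<Oplus>\<^bsub>A\<^esub>i\<in>I. e (f i)) = (\<Oplus>\<^bsub>A\<^esub>i\<in>I. e p \<otimes>\<^bsub>A\<^esub> e (f i))"
    using assms by (intro A.finsum_rdistr) auto
  also have "\<dots> = (\<Oplus>\<^bsub>A\<^esub>i\<in>I. e (p \<circ> f i))"
    using assms by (intro A.finsum_cong') (auto simp: e_mult)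
  finally show ?thesis .
qed

lemma sum_mult_e:
  assumes "p permutes {1..n}" "\<And>i. i \<in> I \<Longrightarrow> f i permutes {1..n}" "finite I"
  shows "(\<Oplus>\<^bsub>A\<^esub>i\<in>I. e (f i)) \<otimes>\<^bsub>A\<^esub> e p = (\<Oplus>\<^bsub>A\<^esub>i\<in>I. e (f i \<circ> p))"
proof -
  have "(\<Oplus>\<^bsub>A\<^esub>i\<in>I. e (f i)) \<otimes>\<^bsub>A\<^esub> e p = (\<Oplus>\<^bsub>A\<^esub>i\<in>I. e (f i) \<otimes>\<^bsub>A\<^esub> e p)"
    using assms by (intro A.finsum_ldistr) auto
  also have "\<dots> = (\<Oplus>\<^bsub>A\<^esub>i\<in>I. e (f i \<circ> p))"
    using assms by (intro A.finsum_cong') (auto simp: e_mult)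
  finally show ?thesis .
qed

lemma e_commute_t:
  assumes "p permutes {1..<j}" "j \<in> {1..n}"
  shows "e p \<otimes>\<^bsub>A\<^esub> t j = t j \<otimes>\<^bsub>A\<^esub> e p"
proof -
  have p: "p permutes {1..n}"
    using assms by (auto intro: permutes_subset)
  have cyc: "cyc j i permutes {1..n}" if "i \<in> {j..n}" for i
    using that assms(2) by (intro cyc_permutes) auto
  have "e p \<otimes>\<^bsub>A\<^esub> t j = (\<Oplus>\<^bsub>A\<^esub>i\<in>{j..n}. e (p \<circ> cyc j i))"
    unfolding t_eq by (intro e_mult_sum p cyc) auto
  also have "\<dots> = (\<Oplus>\<^bsub>A\<^esub>i\<in>{j..n}. e (cyc j i \<circ> p))"
    by (simp only: permutes_commute_cyc[OF assms(1)])
  also have "\<dots> = t j \<otimes>\<^bsub>A\<^esub> e p"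
    unfolding t_eq by (intro sum_mult_e[symmetric] p cyc) auto
  finally show ?thesis .
qed

text \<open>Summands with \<open>i < j\<close> are left alone, as they will commute with
  \<open>t j\<close>; those with \<open>i \<ge> j\<close> share a left factor by
  \<open>cyc_split\<close>.\<close>

lemma t_split:
  assumes "1 \<le> l" "l < j" "j \<le> n"
  shows "t l = (\<Oplus>\<^bsub>A\<^esub>i\<in>{l..<j}. e (cyc l i))
              \<oplus>\<^bsub>A\<^esub> e (cyc l (j - 1) \<circ> transpose (j - 1) j) \<otimes>\<^bsub>A\<^esub> t j"
proof -
  have perm: "cyc l (j - 1) \<circ> transpose (j - 1) j permutes {1..n}"
    using assms by (intro permutes_compose cyc_permutes permutes_swap_id) auto
  have "{l..n} = {l..<j} \<union> {j..n}" using assms by auto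
  then have "t l = (\<Oplus>\<^bsub>A\<^esub>i\<in>{l..<j}. e (cyc l i)) \<oplus>\<^bsub>A\<^esub> (\<Oplus>\<^bsub>A\<^esub>i\<in>{j..n}. e (cyc l i))"
    unfolding t_eq by (simp add: A.finsum_Un_disjoint disjoint_iff)
  also have "(\<Oplus>\<^bsub>A\<^esub>i\<in>{j..n}. e (cyc l i)) =
      (\<Oplus>\<^bsub>A\<^esub>i\<in>{j..n}. e (cyc l (j - 1) \<circ> transpose (j - 1) j \<circ> cyc j i))"
    using assms by (intro A.finsum_cong') (auto simp: cyc_split)
  also have "\<dots> = e (cyc l (j - 1) \<circ> transpose (j - 1) j) \<otimes>\<^bsub>A\<^esub> t j"
    unfolding t_eq using assms by (intro e_mult_sum[symmetric] perm cyc_permutes) auto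
  finally show ?thesis .
qed

text \<open>Left multiplication by the transposition permutes the summands of the product through
  the involution \<open>\<phi>\<close>.\<close>

lemma t_Suc_mult_t_fix:
  assumes "1 \<le> q" "q < n"
  shows "e (transpose q (Suc q)) \<otimes>\<^bsub>A\<^esub> (t (Suc q) \<otimes>\<^bsub>A\<^esub> t q) = t (Suc q) \<otimes>\<^bsub>A\<^esub> t q"
proof -
  define P where "P = {Suc q..n} \<times> {q..n}"
  define F where "F z = cyc (Suc q) (fst z) \<circ> cyc q (snd z)" for z
  \<comment> \<open>The first branch is \<open>cyc_exchange\<close> with \<open>fst z - 1\<close>
    for \<open>i\<close>, which is at least \<open>q\<close> on \<open>P\<close>; the second is
    \<open>cyc_exchange'\<close>.\<close>
  define \<phi> where "\<phi> z = (if fst z \<le> snd z then (snd z, fst z - 1) else (Suc (snd z), fst z))"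
    for z :: "nat \<times> nat"
  have F: "F z permutes {1..n}" if "z \<in> P" for z
    unfolding F_def using that assms
    by (intro permutes_compose cyc_permutes) (auto simp: P_def)
  have inv: "\<phi> z \<in> P" "\<phi> (\<phi> z) = z" if "z \<in> P" for z
    using that assms by (auto simp: \<phi>_def P_def split: if_splits)
  have im: "\<phi> ` P = P"
    using inv by (auto simp: image_iff) (metis inv(1) inv(2))
  have inj: "inj_on \<phi> P"
    by (rule inj_on_inverseI) (rule inv(2))
  have exch: "transpose q (Suc q) \<circ> F z = F (\<phi> z)" if "z \<in> P" for z
    using that cyc_exchange[of q "fst z - 1" "snd z"] cyc_exchange'[of q "snd z" "fst z"]
    by (auto simp: F_def \<phi>_def P_def)
  have "t (Suc q) \<otimes>\<^bsub>A\<^esub> t q = (\<Oplus>\<^bsub>A\<^esub>i\<in>{Suc q..n}. e (cyc (Suc q) i) \<otimes>\<^bsub>A\<^esub> t q)"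
    unfolding t_eq[of "Suc q"] by (intro A.finsum_ldistr) auto
  also have "\<dots> = (\<Oplus>\<^bsub>A\<^esub>i\<in>{Suc q..n}. \<Oplus>\<^bsub>A\<^esub>i'\<in>{q..n}. e (cyc (Suc q) i \<circ> cyc q i'))"
    unfolding t_eq[of q] using assms
    by (intro A.finsum_cong') (auto intro!: e_mult_sum cyc_permutes A.finsum_closed)
  also have "\<dots> = (\<Oplus>\<^bsub>A\<^esub>z\<in>P. e (F z))"
    unfolding P_def F_def by (intro A.finsum_cartesian) auto
  finally have prod: "t (Suc q) \<otimes>\<^bsub>A\<^esub> t q = (\<Oplus>\<^bsub>A\<^esub>z\<in>P. e (F z))" .
  have "e (transpose q (Suc q)) \<otimes>\<^bsub>A\<^esub> (\<Oplus>\<^bsub>A\<^esub>z\<in>P. e (F z)) =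
      (\<Oplus>\<^bsub>A\<^esub>z\<in>P. e (transpose q (Suc q) \<circ> F z))"
    using assms by (intro e_mult_sum F permutes_swap_id) (auto simp: P_def)
  also have "\<dots> = (\<Oplus>\<^bsub>A\<^esub>z\<in>P. e (F (\<phi> z)))"
    by (intro A.finsum_cong') (auto simp: exch)
  also have "\<dots> = (\<Oplus>\<^bsub>A\<^esub>z\<in>\<phi> ` P. e (F z))"
    by (intro A.finsum_reindex[symmetric] inj) auto
  finally show ?thesis
    unfolding prod im .
qed

text \<open>For \<open>p = j - 1\<close> the sum is \<open>t j\<close> times
  \<open>t (j - 1)\<close>, so \<open>t_Suc_mult_t_fix\<close> applies. Other \<open>p\<close>
  follow by conjugating with the transposition of \<open>p\<close> and \<open>j - 1\<close>, which
  commutes with \<open>t j\<close>.\<close>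

lemma transpose_fix:
  assumes "p \<in> {1..<j}" "j \<le> n"
  shows "e (transpose p j) \<otimes>\<^bsub>A\<^esub> (t j \<oplus>\<^bsub>A\<^esub> t j \<otimes>\<^bsub>A\<^esub> (e (transpose p j) \<otimes>\<^bsub>A\<^esub> t j)) =
         t j \<oplus>\<^bsub>A\<^esub> t j \<otimes>\<^bsub>A\<^esub> (e (transpose p j) \<otimes>\<^bsub>A\<^esub> t j)"
proof -
  define q where "q = j - 1"
  have q: "1 \<le> q" "q < n" "j = Suc q" using assms by (auto simp: q_def)
  define S where "S = e (transpose q j)"
  define B where "B = t j"
  define X where "X = B \<oplus>\<^bsub>A\<^esub> B \<otimes>\<^bsub>A\<^esub> (S \<otimes>\<^bsub>A\<^esub> B)"
  have cl: "S \<in> carrier A" "B \<in> carrier A" "X \<in> carrier A" by (simp_all add: S_def B_def X_def)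
  \<comment> \<open>In \<open>t_split\<close> with \<open>l = q = j - 1\<close>, only the identity
    remains below \<open>j\<close>, and the left cycle is trivial too.\<close>
  have "t q = \<one>\<^bsub>A\<^esub> \<oplus>\<^bsub>A\<^esub> S \<otimes>\<^bsub>A\<^esub> B"
    using t_split[of q j] q by (simp add: cyc_refl e_id S_def B_def)
  then have "B \<otimes>\<^bsub>A\<^esub> t q = X"
    using cl by (simp add: X_def A.r_distr)
  then have fix_q: "S \<otimes>\<^bsub>A\<^esub> X = X"
    using t_Suc_mult_t_fix[OF q(1,2)] by (simp add: S_def B_def q(3))
  show ?thesis
  proof (cases "p = q")
    case True
    then show ?thesis using fix_q by (simp add: X_def S_def B_def)
  next
    case False
    then have pq: "p < q" "1 \<le> p" using assms by (auto simp: q_def)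
    define P where "P = e (transpose p q)"
    have P: "P \<in> carrier A" by (simp add: P_def)
    have perm: "transpose p q permutes {1..n}" "transpose q j permutes {1..n}"
      using pq q by (auto intro!: permutes_swap_id)
    have PP: "P \<otimes>\<^bsub>A\<^esub> P = \<one>\<^bsub>A\<^esub>"
      using perm by (simp add: P_def e_mult e_id[symmetric])
    have PB: "P \<otimes>\<^bsub>A\<^esub> B = B \<otimes>\<^bsub>A\<^esub> P"
      unfolding P_def B_def using pq q by (intro e_commute_t permutes_swap_id) auto
    have "transpose p j = transpose p q \<circ> (transpose q j \<circ> transpose p q)"
      using pq q by (auto simp: fun_eq_iff transpose_def)
    then have T: "e (transpose p j) = P \<otimes>\<^bsub>A\<^esub> (S \<otimes>\<^bsub>A\<^esub> P)"
      using perm by (simp add: P_def S_def e_mult permutes_compose)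
    have "P \<otimes>\<^bsub>A\<^esub> (X \<otimes>\<^bsub>A\<^esub> P) =
        P \<otimes>\<^bsub>A\<^esub> (B \<otimes>\<^bsub>A\<^esub> P) \<oplus>\<^bsub>A\<^esub> (P \<otimes>\<^bsub>A\<^esub> B) \<otimes>\<^bsub>A\<^esub> (S \<otimes>\<^bsub>A\<^esub> (B \<otimes>\<^bsub>A\<^esub> P))"
      unfolding X_def using cl P by algebra
    also have "P \<otimes>\<^bsub>A\<^esub> (B \<otimes>\<^bsub>A\<^esub> P) = B"
      unfolding PB[symmetric] using cl P PP by (simp add: A.m_assoc[symmetric])
    also have "P \<otimes>\<^bsub>A\<^esub> B \<otimes>\<^bsub>A\<^esub> (S \<otimes>\<^bsub>A\<^esub> (B \<otimes>\<^bsub>A\<^esub> P)) =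
        B \<otimes>\<^bsub>A\<^esub> (e (transpose p j) \<otimes>\<^bsub>A\<^esub> B)"
      unfolding PB T using cl P by (simp add: A.m_assoc PB)
    finally have conj: "B \<oplus>\<^bsub>A\<^esub> B \<otimes>\<^bsub>A\<^esub> (e (transpose p j) \<otimes>\<^bsub>A\<^esub> B) =
        P \<otimes>\<^bsub>A\<^esub> (X \<otimes>\<^bsub>A\<^esub> P)" by simp
    have "e (transpose p j) \<otimes>\<^bsub>A\<^esub> (P \<otimes>\<^bsub>A\<^esub> (X \<otimes>\<^bsub>A\<^esub> P)) =
        P \<otimes>\<^bsub>A\<^esub> (S \<otimes>\<^bsub>A\<^esub> ((P \<otimes>\<^bsub>A\<^esub> P) \<otimes>\<^bsub>A\<^esub> (X \<otimes>\<^bsub>A\<^esub> P)))"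
      unfolding T using cl P by (simp add: A.m_assoc)
    also have "\<dots> = P \<otimes>\<^bsub>A\<^esub> ((S \<otimes>\<^bsub>A\<^esub> X) \<otimes>\<^bsub>A\<^esub> P)"
      unfolding PP using cl P by (simp add: A.m_assoc)
    finally show ?thesis
      unfolding fix_q conj[unfolded B_def] .
  qed
qed

text \<open>By \<open>t_split\<close>, \<open>t l = D + W S B\<close>. Since \<open>D\<close> and
  \<open>W\<close> commute with \<open>B\<close>, the part \<open>D\<close> drops out and
  \<open>W\<close> can be pulled to the front.\<close>

lemma commutator_t_eq:
  assumes "l \<in> {1..<j}" "j \<le> n"
  shows "ring_commutator A (t l) (t j) =
    e (cyc l (j - 1)) \<otimes>\<^bsub>A\<^esub>
      ((e (transpose (j - 1) j) \<otimes>\<^bsub>A\<^esub> t j \<ominus>\<^bsub>A\<^esub> t j \<otimes>\<^bsub>A\<^esub> e (transpose (j - 1) j)) \<otimes>\<^bsub>A\<^esub> t j)"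
proof -
  define B S W where "B = t j" and "S = e (transpose (j - 1) j)" and "W = e (cyc l (j - 1))"
  define D where "D = (\<Oplus>\<^bsub>A\<^esub>i\<in>{l..<j}. e (cyc l i))"
  have D: "D \<in> carrier A" unfolding D_def by (intro A.finsum_closed) auto
  have cl: "B \<in> carrier A" "S \<in> carrier A" "W \<in> carrier A"
    by (simp_all add: B_def S_def W_def)
  \<comment> \<open>\<open>cyc_permutes\<close> is taken with bound \<open>i\<close> instead of
    \<open>n\<close>, to place the support inside \<open>{1..<j}\<close>.\<close>
  have comm: "e (cyc l i) \<otimes>\<^bsub>A\<^esub> B = B \<otimes>\<^bsub>A\<^esub> e (cyc l i)" if "i < j" for i
    unfolding B_def using that assms
    by (intro e_commute_t permutes_subset[OF cyc_permutes[of l i i]]) auto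
  have WB: "W \<otimes>\<^bsub>A\<^esub> B = B \<otimes>\<^bsub>A\<^esub> W"
    unfolding W_def using assms by (intro comm) auto
  have "D \<otimes>\<^bsub>A\<^esub> B = (\<Oplus>\<^bsub>A\<^esub>i\<in>{l..<j}. e (cyc l i) \<otimes>\<^bsub>A\<^esub> B)"
    unfolding D_def using cl by (intro A.finsum_ldistr) auto
  also have "\<dots> = (\<Oplus>\<^bsub>A\<^esub>i\<in>{l..<j}. B \<otimes>\<^bsub>A\<^esub> e (cyc l i))"
    using cl by (intro A.finsum_cong') (auto simp: comm)
  also have "\<dots> = B \<otimes>\<^bsub>A\<^esub> D"
    unfolding D_def using cl by (intro A.finsum_rdistr[symmetric]) auto
  finally have DB: "D \<otimes>\<^bsub>A\<^esub> B = B \<otimes>\<^bsub>A\<^esub> D" .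
  have "e (cyc l (j - 1) \<circ> transpose (j - 1) j) = W \<otimes>\<^bsub>A\<^esub> S"
    unfolding W_def S_def using assms
    by (intro e_mult[symmetric] cyc_permutes permutes_swap_id) auto
  then have t: "t l = D \<oplus>\<^bsub>A\<^esub> W \<otimes>\<^bsub>A\<^esub> S \<otimes>\<^bsub>A\<^esub> B"
    using t_split[of l j] assms by (simp add: D_def B_def)
  have "ring_commutator A (t l) B =
      D \<otimes>\<^bsub>A\<^esub> B \<oplus>\<^bsub>A\<^esub> W \<otimes>\<^bsub>A\<^esub> S \<otimes>\<^bsub>A\<^esub> B \<otimes>\<^bsub>A\<^esub> B
      \<ominus>\<^bsub>A\<^esub> (B \<otimes>\<^bsub>A\<^esub> D \<oplus>\<^bsub>A\<^esub> B \<otimes>\<^bsub>A\<^esub> W \<otimes>\<^bsub>A\<^esub> S \<otimes>\<^bsub>A\<^esub> B)"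
    unfolding ring_commutator_def t using cl D by algebra
  also have "\<dots> = W \<otimes>\<^bsub>A\<^esub> ((S \<otimes>\<^bsub>A\<^esub> B \<ominus>\<^bsub>A\<^esub> B \<otimes>\<^bsub>A\<^esub> S) \<otimes>\<^bsub>A\<^esub> B)"
    unfolding DB WB[symmetric] using cl D by algebra
  finally show ?thesis
    unfolding B_def S_def W_def .
qed

lemma shuffle_relations_sym_algebra:
  assumes j: "j \<in> {1..n}"
  shows "shuffle_relations A j (t j) (\<lambda>p. e (transpose p j)) (\<lambda>p. e (transpose p (j - 1)))
           (\<lambda>l. e (cyc l (j - 1))) (\<lambda>l. ring_commutator A (t l) (t j))"
\<comment> \<open>The cases follow the order of the locale assumptions; the closure conditions 1 to
  4 go to the final \<open>auto\<close>.\<close>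
proof (unfold_locales, goal_cases)
  case (5 p)
  then show ?case using j by (intro transpose_fix) auto
next
  case (6 p)
  then show ?case using j by (intro e_commute_t permutes_swap_id) auto
next
  case (7 p)
  then have perm: "transpose p (j - 1) permutes {1..n}" "transpose (j - 1) j permutes {1..n}"
      "transpose p j permutes {1..n}"
    using j by (auto intro!: permutes_swap_id)
  have "transpose p (j - 1) \<circ> transpose (j - 1) j = transpose (j - 1) j \<circ> transpose p j"
    using 7 by (auto simp: fun_eq_iff transpose_def)
  then show ?case using perm by (simp add: e_mult)
next
  case (8 p)
  then have perm: "transpose p (j - 1) permutes {1..n}" "transpose (j - 1) j permutes {1..n}"
    using j by (auto intro!: permutes_swap_id)
  have "transpose (j - 1) j \<circ> (transpose p (j - 1) \<circ> transpose (j - 1) j) = transpose p j"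
    using 8 by (auto simp: fun_eq_iff transpose_def)
  then show ?case using perm by (simp add: e_mult permutes_compose)
next
  case (9 l)
  then show ?case
    using j by (intro e_commute_t permutes_subset[OF cyc_permutes[of l "j - 1" "j - 1"]]) auto
next
  case (10 l)
  then have perm: "cyc l (j - 1) permutes {1..n}" "transpose (j - 1) j permutes {1..n}"
      "transpose l j permutes {1..n}"
    using j by (auto intro!: permutes_swap_id cyc_permutes[simplified])
  \<comment> \<open>Conjugation replaces entries by their images: the cycle sends
    \<open>j - 1\<close> to \<open>l\<close> and fixes \<open>j\<close>.\<close>
  have "transpose l j \<circ> cyc l (j - 1) = cyc l (j - 1) \<circ> transpose (j - 1) j"
    using 10 by (subst inj_comp_transpose) (auto simp: inj_cyc cyc_apply)
  then show ?case using perm by (simp add: e_mult)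
next
  case (11 l p)
  then have perm: "cyc l (j - 1) permutes {1..n}" "transpose p j permutes {1..n}"
      "transpose (Suc p) j permutes {1..n}"
    using j by (auto intro!: permutes_swap_id cyc_permutes[simplified])
  \<comment> \<open>The same conjugation; \<open>l \<le> p < j - 1\<close> makes the cycle send
    \<open>p\<close> to \<open>Suc p\<close>.\<close>
  have "transpose (Suc p) j \<circ> cyc l (j - 1) = cyc l (j - 1) \<circ> transpose p j"
    using 11 by (subst inj_comp_transpose) (auto simp: inj_cyc cyc_apply)
  then show ?case using perm by (simp add: e_mult)
next
  case (12 l)
  then show ?case using j by (intro commutator_t_eq) auto
next
  case 13
  then show ?case by (simp add: ring_commutator_def A.minus_eq A.r_neg)
qed auto

end

theorem theorem9p10:
  fixes R :: "('r, 's) ring_scheme" and n j m :: nat and k :: "nat \<Rightarrow> nat"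
  assumes "cring R"
    and "j \<in> {1..n}"
    and "m \<ge> 1"
    and "\<forall>i\<in>{1..m}. k i \<in> {1..j}"
    and "m \<ge> j - k m + 1"
  shows "foldr (\<otimes>\<^bsub>sym_algebra R n\<^esub>)
           (map (\<lambda>i. ring_commutator (sym_algebra R n)
                       (somewhere_to_below R n (k i)) (somewhere_to_below R n j)) [1..<m + 1])
           \<one>\<^bsub>sym_algebra R n\<^esub>
         = \<zero>\<^bsub>sym_algebra R n\<^esub>"
proof -
  interpret cring R by fact
  interpret sym_algebra_cring R n ..
  interpret S: shuffle_relations A j "t j" "\<lambda>p. e (transpose p j)" "\<lambda>p. e (transpose p (j - 1))"
      "\<lambda>l. e (cyc l (j - 1))" "\<lambda>l. ring_commutator A (t l) (t j)"
    by (rule shuffle_relations_sym_algebra) fact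
  \<comment> \<open>The last factor is split off because it sets the starting level
    \<open>k m\<close>. The other \<open>m - 1\<close> factors suffice, as the hypothesis on
    \<open>m\<close> says \<open>j \<le> k m + (m - 1)\<close>.\<close>
  have "[1..<m + 1] = [1..<m] @ [m]"
    using assms(3) by simp
  then have "map k [1..<m + 1] = map k [1..<m] @ [k m]"
    by simp
  moreover have "foldr (\<otimes>\<^bsub>A\<^esub>)
      (map (\<lambda>l. ring_commutator A (t l) (t j)) (map k [1..<m] @ [k m])) \<one>\<^bsub>A\<^esub> = \<zero>\<^bsub>A\<^esub>"
    using assms(3-5) by (intro S.foldr_C_eq_zero) auto
  ultimately show ?thesis
    by (metis (no_types, lifting) map_map comp_def map_cong)
qed

end
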